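(* Let $(X,q)$ be a quasi-metric space with $X$ nonempty, and let $\Phi:X\rightrightarrows X$ be a set-valued mapping. Assume that: (F1) if $u\in\Phi(x)$, then $\Phi(u)\subset\Phi(x)$, for all $u,x\in X$; (F2) for any generalized Picard sequence $\{x_n\}\subset X$ of $\Phi$, if $\lim_{n\to\infty}\sup_{x\in\Phi(x_n)}q(x_n,x)=0$, then there exists some element $x_\ast\in X$ such that $x_\ast\in\Phi(x_n)$ for all $n\in\mathbb{N}$; (F3) any forward Cauchy generalized Picard sequence $\{x_n\}\subset X$ of $\Phi$ has at most one forward limit; (F4) for each generalized Picard sequence $\{x_n\}\subset X$ of $\Phi$, $\lim_{n\to+\infty}q(x_n,x_{n+1})=0$. Then $\Phi$ has a nonvariant point $\bar{x}\in X$, in the sense that $\Phi(\bar{x})\subset\{\bar{x}\}$. If, furthermore, $\Phi(\bar{x})\neq\emptyset$, then $\bar{x}$ is an invariant point of $\Phi$, i.e., $\Phi(\bar{x})=\{\bar{x}\}$.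
   Context: A quasi-metric space is a pair $(X,q)$ consisting of a set $X$ and a function $q:X\times X\to\mathbb{R}_+=[0,\infty)$ such that $q(x,x)=0$ for all $x\in X$ and $q(x,z)\le q(x,y)+q(y,z)$ for all $x,y,z\in X$. Symmetry is not required, and $q(x,y)=0$ is not required to imply $x=y$. A set-valued mapping $\Phi:X\rightrightarrows X$ assigns to each $x\in X$ a (possibly empty) subset $\Phi(x)$ of $X$. A sequence $\{x_n\}_{n\in\mathbb{N}}\subset X$ is a generalized Picard sequence of $\Phi$ if $x_{n+1}\in\Phi(x_n)$ for all $n\in\mathbb{N}$. A point $x_\infty\in X$ is a forward limit of a sequence $\{x_n\}$ if $\lim_{n\to\infty}q(x_n,x_\infty)=0$. A sequence $\{x_n\}$ is forward Cauchy if for every $\varepsilon>0$ there is $N_\varepsilon\in\mathbb{N}$ such that $q(x_n,x_{n+k})<\varepsilon$ for every $n\ge N_\varepsilon$ and every $k\in\mathbb{N}$. *)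

theory Defs
  imports Complex_Main "HOL-Library.Extended_Real"
begin

definition quasi_metric_space :: "'a set \<Rightarrow> ('a \<Rightarrow> 'a \<Rightarrow> real) \<Rightarrow> bool" where
  "quasi_metric_space X q \<longleftrightarrow>
     (\<forall>x\<in>X. \<forall>y\<in>X. 0 \<le> q x y) \<and>
     (\<forall>x\<in>X. q x x = 0) \<and>
     (\<forall>x\<in>X. \<forall>y\<in>X. \<forall>z\<in>X. q x z \<le> q x y + q y z)"

definition set_valued_map :: "'a set \<Rightarrow> ('a \<Rightarrow> 'a set) \<Rightarrow> bool" where
  "set_valued_map X \<Phi> \<longleftrightarrow> (\<forall>x\<in>X. \<Phi> x \<subseteq> X)"

definition gen_picard :: "'a set \<Rightarrow> ('a \<Rightarrow> 'a set) \<Rightarrow> (nat \<Rightarrow> 'a) \<Rightarrow> bool" where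
  "gen_picard X \<Phi> x \<longleftrightarrow> (\<forall>n. x n \<in> X) \<and> (\<forall>n. x (Suc n) \<in> \<Phi> (x n))"

definition forward_limit :: "'a set \<Rightarrow> ('a \<Rightarrow> 'a \<Rightarrow> real) \<Rightarrow> (nat \<Rightarrow> 'a) \<Rightarrow> 'a \<Rightarrow> bool" where
  "forward_limit X q x l \<longleftrightarrow> l \<in> X \<and> (\<lambda>n. q (x n) l) \<longlonglongrightarrow> 0"

definition forward_Cauchy :: "('a \<Rightarrow> 'a \<Rightarrow> real) \<Rightarrow> (nat \<Rightarrow> 'a) \<Rightarrow> bool" where
  "forward_Cauchy q x \<longleftrightarrow> (\<forall>\<epsilon>>0. \<exists>N. \<forall>n\<ge>N. \<forall>k. q (x n) (x (n + k)) < \<epsilon>)"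

(* The supremum of the distances q(x, y) over y in \<Phi>(x) may be infinite, so it is
   taken in the extended reals.  Along a generalized Picard sequence the set \<Phi>(x)
   is nonempty, so the value of the empty supremum plays no role there. *)
definition sup_dist :: "('a \<Rightarrow> 'a \<Rightarrow> real) \<Rightarrow> ('a \<Rightarrow> 'a set) \<Rightarrow> 'a \<Rightarrow> ereal" where
  "sup_dist q \<Phi> x = (SUP y\<in>\<Phi> x. ereal (q x y))"

definition nonvariant_point :: "'a set \<Rightarrow> ('a \<Rightarrow> 'a set) \<Rightarrow> 'a \<Rightarrow> bool" where
  "nonvariant_point X \<Phi> x \<longleftrightarrow> x \<in> X \<and> \<Phi> x \<subseteq> {x}"

definition invariant_point :: "'a set \<Rightarrow> ('a \<Rightarrow> 'a set) \<Rightarrow> 'a \<Rightarrow> bool" where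
  "invariant_point X \<Phi> x \<longleftrightarrow> x \<in> X \<and> \<Phi> x = {x}"

end

theory Submission
  imports Defs
begin

text \<open>
  If some value of \<open>\<Phi>\<close> is empty, the point at which this happens is nonvariant.  Otherwise one runs
  a greedy Picard iteration, as in the usual proof of Ekeland's variational principle: the step from
  \<open>x\<close> to some \<open>y \<in> \<Phi> x\<close> is at least half as long as any step available at \<open>x\<close>, with lengths
  truncated at 1 because \<open>\<Phi> x\<close> may be unbounded (\<open>half_maximal_element\<close>).  By (F4) the steps
  tend to 0, hence so do the suprema of the available steps
  (\<open>sup_dist_tendsto_0_if_greedy\<close>), and (F2) provides a point \<open>l\<close> in every \<open>\<Phi> (x n)\<close>.

  By (F1) the values \<open>\<Phi> (x n)\<close> decrease, so \<open>\<Phi> (x n)\<close> contains all later terms of the sequence,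
  as well as \<open>l\<close> and all of \<open>\<Phi> l\<close>.  Everything in these sets lies within \<open>sup_dist q \<Phi> (x n)\<close> of
  \<open>x n\<close>, so the sequence is forward Cauchy and both \<open>l\<close> and every point of \<open>\<Phi> l\<close> are forward
  limits of it.  Uniqueness of forward limits (F3) then gives \<open>\<Phi> l \<subseteq> {l}\<close>.
\<close>

text \<open>
  The truncation keeps the supremum finite.  If it is positive, some value exceeds half of it; if it is
  0, every element will do.
\<close>
lemma half_maximal_element:
  fixes f :: "'a \<Rightarrow> real"
  assumes "A \<noteq> {}" and nonneg: "\<And>y. y \<in> A \<Longrightarrow> 0 \<le> f y"
  shows "\<exists>y\<in>A. \<forall>z\<in>A. min (f z) 1 \<le> 2 * f y"
proof -
  define s where "s = (SUP z\<in>A. min (f z) 1)"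
  have bdd: "bdd_above ((\<lambda>z. min (f z) 1) ` A)"
    by (intro bdd_aboveI[of _ 1]) auto
  have le_s: "min (f z) 1 \<le> s" if "z \<in> A" for z
    unfolding s_def using bdd that by (rule cSUP_upper2) simp
  show ?thesis
  proof (cases "0 < s")
    case True
    then have "s / 2 < (SUP z\<in>A. min (f z) 1)"
      by (simp add: s_def)
    then obtain y where "y \<in> A" "s / 2 < min (f y) 1"
      using less_cSUP_iff[OF \<open>A \<noteq> {}\<close> bdd] by blast
    moreover have "min (f z) 1 \<le> 2 * f y" if "z \<in> A" for z
      using le_s[OF that] \<open>s / 2 < min (f y) 1\<close> by linarith
    ultimately show ?thesis by blast
  next
    case False
    obtain y where "y \<in> A" using \<open>A \<noteq> {}\<close> by blast
    moreover have "min (f z) 1 \<le> 2 * f y" if "z \<in> A" for z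
      using le_s[OF that] nonneg[OF \<open>y \<in> A\<close>] False by linarith
    ultimately show ?thesis by blast
  qed
qed

lemma le_sup_dist: "y \<in> \<Phi> x \<Longrightarrow> ereal (q x y) \<le> sup_dist q \<Phi> x"
  unfolding sup_dist_def by (rule SUP_upper)

text \<open>
  As soon as a step is shorter than \<open>1/2\<close>, the truncation at 1 is inactive, and twice the step length
  bounds the supremum.
\<close>
lemma sup_dist_tendsto_0_if_greedy:
  assumes step: "\<And>n. x (Suc n) \<in> \<Phi> (x n)"
    and nonneg: "\<And>n. 0 \<le> q (x n) (x (Suc n))"
    and greedy: "\<And>n z. z \<in> \<Phi> (x n) \<Longrightarrow> min (q (x n) z) 1 \<le> 2 * q (x n) (x (Suc n))"
    and lim: "(\<lambda>n. q (x n) (x (Suc n))) \<longlonglongrightarrow> 0"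
  shows "(\<lambda>n. sup_dist q \<Phi> (x n)) \<longlonglongrightarrow> 0"
proof (rule tendsto_sandwich)
  have "0 \<le> sup_dist q \<Phi> (x n)" for n
    by (rule order_trans[OF _ le_sup_dist[where \<Phi> = \<Phi>, OF step]]) (simp add: nonneg)
  then show "\<forall>\<^sub>F n in sequentially. 0 \<le> sup_dist q \<Phi> (x n)"
    by simp
  have "\<forall>\<^sub>F n in sequentially. q (x n) (x (Suc n)) < 1/2"
    using lim by (rule order_tendstoD) simp
  then show "\<forall>\<^sub>F n in sequentially. sup_dist q \<Phi> (x n) \<le> ereal (2 * q (x n) (x (Suc n)))"
  proof eventually_elim
    case (elim n)
    have "q (x n) z \<le> 2 * q (x n) (x (Suc n))" if "z \<in> \<Phi> (x n)" for z
      using greedy[OF that] elim by linarith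
    then show ?case
      unfolding sup_dist_def by (intro SUP_least) simp
  qed
  have "(\<lambda>n. 2 * q (x n) (x (Suc n))) \<longlonglongrightarrow> 0"
    using tendsto_mult_left[OF lim, of 2] by simp
  then show "(\<lambda>n. ereal (2 * q (x n) (x (Suc n)))) \<longlonglongrightarrow> 0"
    by (simp add: zero_ereal_def)
qed simp

lemma gen_picard_later_mem:
  assumes picard: "gen_picard X \<Phi> x"
    and F1: "\<And>x u. x \<in> X \<Longrightarrow> u \<in> X \<Longrightarrow> u \<in> \<Phi> x \<Longrightarrow> \<Phi> u \<subseteq> \<Phi> x"
  shows "x (n + Suc k) \<in> \<Phi> (x n)"
proof -
  have "\<Phi> (x (Suc n)) \<subseteq> \<Phi> (x n)" for n
    by (rule F1) (use picard in \<open>auto simp: gen_picard_def\<close>)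
  then have "\<Phi> (x (n + k)) \<subseteq> \<Phi> (x n)"
    by (rule lift_Suc_antimono_le[where f = "\<lambda>n. \<Phi> (x n)"]) simp
  then show ?thesis
    using picard unfolding gen_picard_def by auto
qed

text \<open>
  All terms after the \<open>n\<close>-th lie in \<open>\<Phi> (x n)\<close>, so the supremum over this set bounds the distances
  from \<open>x n\<close> to all of them at once.
\<close>
lemma forward_Cauchy_if_sup_dist_tendsto_0:
  assumes q: "quasi_metric_space X q" and picard: "gen_picard X \<Phi> x"
    and F1: "\<And>x u. x \<in> X \<Longrightarrow> u \<in> X \<Longrightarrow> u \<in> \<Phi> x \<Longrightarrow> \<Phi> u \<subseteq> \<Phi> x"
    and lim: "(\<lambda>n. sup_dist q \<Phi> (x n)) \<longlonglongrightarrow> 0"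
  shows "forward_Cauchy q x"
  unfolding forward_Cauchy_def
proof (intro allI impI)
  fix e :: real assume "0 < e"
  then have "\<forall>\<^sub>F n in sequentially. sup_dist q \<Phi> (x n) < ereal e"
    by (intro order_tendstoD[OF lim]) simp
  then obtain N where N: "\<And>n. n \<ge> N \<Longrightarrow> sup_dist q \<Phi> (x n) < ereal e"
    unfolding eventually_sequentially by blast
  have "q (x n) (x (n + k)) < e" if "n \<ge> N" for n k
  proof (cases k)
    case 0
    then show ?thesis
      using q picard \<open>0 < e\<close> unfolding quasi_metric_space_def gen_picard_def by simp
  next
    case (Suc j)
    have "x (n + k) \<in> \<Phi> (x n)"
      unfolding Suc using picard F1 by (rule gen_picard_later_mem)
    then have "ereal (q (x n) (x (n + k))) < ereal e"
      by (intro le_less_trans[OF le_sup_dist N[OF that]])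
    then show ?thesis by simp
  qed
  then show "\<exists>N. \<forall>n\<ge>N. \<forall>k. q (x n) (x (n + k)) < e"
    by blast
qed

lemma forward_limit_if_mem_all:
  assumes q: "quasi_metric_space X q" and picard: "gen_picard X \<Phi> x"
    and lim: "(\<lambda>n. sup_dist q \<Phi> (x n)) \<longlonglongrightarrow> 0"
    and "z \<in> X" and mem: "\<And>n. z \<in> \<Phi> (x n)"
  shows "forward_limit X q x z"
proof -
  have "(\<lambda>n. ereal (q (x n) z)) \<longlonglongrightarrow> 0"
  proof (rule tendsto_sandwich)
    show "\<forall>\<^sub>F n in sequentially. 0 \<le> ereal (q (x n) z)"
      using q picard \<open>z \<in> X\<close> unfolding quasi_metric_space_def gen_picard_def by simp
    show "\<forall>\<^sub>F n in sequentially. ereal (q (x n) z) \<le> sup_dist q \<Phi> (x n)"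
      by (simp add: le_sup_dist mem)
  qed (use lim in simp_all)
  then show ?thesis
    using \<open>z \<in> X\<close> by (simp add: forward_limit_def zero_ereal_def)
qed

theorem theorem4p5:
  fixes X :: "'a set" and q :: "'a \<Rightarrow> 'a \<Rightarrow> real" and \<Phi> :: "'a \<Rightarrow> 'a set"
  assumes "quasi_metric_space X q" and "X \<noteq> {}" and "set_valued_map X \<Phi>"
    and F1: "\<And>x u. x \<in> X \<Longrightarrow> u \<in> X \<Longrightarrow> u \<in> \<Phi> x \<Longrightarrow> \<Phi> u \<subseteq> \<Phi> x"
    and F2: "\<And>x. gen_picard X \<Phi> x \<Longrightarrow> (\<lambda>n. sup_dist q \<Phi> (x n)) \<longlonglongrightarrow> 0 \<Longrightarrow>
               \<exists>l\<in>X. \<forall>n. l \<in> \<Phi> (x n)"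
    and F3: "\<And>x l l'. gen_picard X \<Phi> x \<Longrightarrow> forward_Cauchy q x \<Longrightarrow>
               forward_limit X q x l \<Longrightarrow> forward_limit X q x l' \<Longrightarrow> l = l'"
    and F4: "\<And>x. gen_picard X \<Phi> x \<Longrightarrow> (\<lambda>n. q (x n) (x (Suc n))) \<longlonglongrightarrow> 0"
  shows "\<exists>xbar. nonvariant_point X \<Phi> xbar \<and>
           (\<Phi> xbar \<noteq> {} \<longrightarrow> invariant_point X \<Phi> xbar)"
proof -
  note q = assms(1)
  have \<Phi>_X: "y \<in> X" if "x \<in> X" "y \<in> \<Phi> x" for x y
    using assms(3) that unfolding set_valued_map_def by blast
  have nonneg: "0 \<le> q x y" if "x \<in> X" "y \<in> X" for x y
    using q that unfolding quasi_metric_space_def by blast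
  have "\<exists>l\<in>X. \<Phi> l \<subseteq> {l}"
  proof (cases "\<exists>l\<in>X. \<Phi> l = {}")
    case True
    then show ?thesis by blast
  next
    case False
    have "\<exists>y\<in>\<Phi> x. \<forall>z\<in>\<Phi> x. min (q x z) 1 \<le> 2 * q x y" if "x \<in> X" for x
      using False that by (intro half_maximal_element) (blast, metis nonneg \<Phi>_X)
    then have "\<forall>x\<in>X. \<exists>y. y \<in> \<Phi> x \<and> (\<forall>z\<in>\<Phi> x. min (q x z) 1 \<le> 2 * q x y)"
      by blast
    from bchoice[OF this] obtain g where g: "\<And>x. x \<in> X \<Longrightarrow> g x \<in> \<Phi> x"
      and g_greedy: "\<And>x z. x \<in> X \<Longrightarrow> z \<in> \<Phi> x \<Longrightarrow> min (q x z) 1 \<le> 2 * q x (g x)"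
      by blast
    obtain x0 where "x0 \<in> X" using \<open>X \<noteq> {}\<close> by blast
    define x where "x n = (g ^^ n) x0" for n
    have x_Suc: "x (Suc n) = g (x n)" for n
      by (simp add: x_def)
    have xX: "x n \<in> X" for n
    proof (induction n)
      case 0
      show ?case by (simp add: x_def \<open>x0 \<in> X\<close>)
    next
      case (Suc n)
      show ?case unfolding x_Suc by (rule \<Phi>_X[OF Suc.IH g[OF Suc.IH]])
    qed
    have picard: "gen_picard X \<Phi> x"
      unfolding gen_picard_def by (simp add: xX x_Suc g)
    have lim: "(\<lambda>n. sup_dist q \<Phi> (x n)) \<longlonglongrightarrow> 0"
    proof (rule sup_dist_tendsto_0_if_greedy)
      show "min (q (x n) z) 1 \<le> 2 * q (x n) (x (Suc n))" if "z \<in> \<Phi> (x n)" for n z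
        using g_greedy[OF xX that] by (simp add: x_Suc)
    qed (use xX F4[OF picard] in \<open>simp_all add: x_Suc g nonneg \<Phi>_X[OF _ g]\<close>)
    obtain l where l: "l \<in> X" "\<And>n. l \<in> \<Phi> (x n)"
      using F2[OF picard lim] by blast
    have cauchy: "forward_Cauchy q x"
      using q picard F1 lim by (rule forward_Cauchy_if_sup_dist_tendsto_0)
    have "z = l" if "z \<in> \<Phi> l" for z
    proof (rule F3[OF picard cauchy])
      show "forward_limit X q x l"
        using q picard lim l by (rule forward_limit_if_mem_all)
      have "z \<in> \<Phi> (x n)" for n
        using F1[OF xX l] that by blast
      with q picard lim \<Phi>_X[OF l(1) that] show "forward_limit X q x z"
        by (rule forward_limit_if_mem_all)
    qed
    then show ?thesis using l(1) by blast
  qed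
  then show ?thesis
    unfolding nonvariant_point_def invariant_point_def by blast
qed

end
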